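(* Let $A$ be a finite alphabet and $A^+$ the set of non-empty words over $A$. The pruning coproduct of the series $H=\sum_{w\in A^+}H_{(w)}$ reads $$\Delta(H)=1\otimes H+H\otimes1+H\otimes H .$$
   Context: $\Bbbk$ is a field of characteristic zero. A sentence over $A$ is a finite sequence of non-empty words in letters of $A$; $1$ is the empty sentence; $I\cdot J$ is concatenation of sequences of words. $\mathrm{NSym}_A$ is the Hopf algebra over $\Bbbk$ with linear basis $(H_I)$ indexed by sentences, graded by the total number of letters, with $H_1=1$, product $H_IH_J=H_{I\cdot J}$, and (pruning) coproduct the algebra morphism $\Delta$ determined by $\Delta(H_{(w)})=\sum_{uv=w}H_{(u)}\otimes H_{(v)}$ for words $w$ (sum over all factorizations into a possibly empty prefix $u$ and suffix $v$, with $H_{(1)}=1$ for the empty word). A formal series is a possibly infinite combination $G=\sum_I g_IH_I$ with $g_I\in\Bbbk$, i.e. an element of the full linear dual of the graded dual $\mathrm{QSym}_A$ of $\mathrm{NSym}_A$. The coproduct is extended to series by $\Delta(G)=\sum_I g_I\Delta(H_I)$, understood coefficientwise as a formal series in the elements $H_J\otimes H_K$, and $G_1\otimes G_2$ for series is understood coefficientwise. *)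

theory Defs
  imports
    "HOL-Library.Poly_Mapping"
    "HOL-Library.Product_Plus"
    "HOL-Library.Function_Algebras"
    "HOL-Library.Multiset"
begin

text \<open>
  The letters are the elements of an arbitrary type, and an alphabet is a set \<open>A\<close> of letters.
  NSym over \<open>A\<close> is the span of the basis elements indexed by the sentences over \<open>A\<close>; it is closed
  under product and coproduct (see \<open>keys_nsym_mult\<close>, \<open>keys_coprod\<close>), so both are
  defined once, independently of \<open>A\<close>.
\<close>

typedef 'a sentence = "{I :: 'a list list. [] \<notin> set I}"
  morphisms words Sentence
  by (rule exI[of _ "[]"]) simp

setup_lifting type_definition_sentence

text \<open>Sentences form a monoid under concatenation, written additively as
  \<^typ>\<open>'b \<Rightarrow>\<^sub>0 'c\<close> requires; \<open>0\<close> is the empty sentence.\<close>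

instantiation sentence :: (type) monoid_add
begin

lift_definition zero_sentence :: "'a sentence" is "[]" by simp

lift_definition plus_sentence :: "'a sentence \<Rightarrow> 'a sentence \<Rightarrow> 'a sentence" is "(@)" by simp

instance by standard (transfer; simp)+

end

definition nonempty_words :: "'a set \<Rightarrow> 'a list set" where
  "nonempty_words A = lists A - {[]}"

definition sentences :: "'a set \<Rightarrow> 'a sentence set" where
  "sentences A = {I. set (words I) \<subseteq> nonempty_words A}"

text \<open>The sentence with the single word \<open>w\<close>; the empty word gives the empty sentence.\<close>

lift_definition word_sentence :: "'a list \<Rightarrow> 'a sentence" is
  "\<lambda>w. if w = [] then [] else [w]" by simp

text \<open>Multiplication of \<^typ>\<open>'b \<Rightarrow>\<^sub>0 'c\<close> is convolution, so these are algebras with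
  \<open>H\<^sub>I H\<^sub>J = H\<^bsub>I\<cdot>J\<^esub>\<close>, and with the componentwise product on the tensor square,
  where the pair \<open>(J, K)\<close> indexes the basis element \<open>H\<^sub>J \<otimes> H\<^sub>K\<close>.\<close>

type_synonym ('a, 'k) nsym = "'a sentence \<Rightarrow>\<^sub>0 'k"
type_synonym ('a, 'k) nsym2 = "('a sentence \<times> 'a sentence) \<Rightarrow>\<^sub>0 'k"

definition nsym_H :: "'a sentence \<Rightarrow> ('a, 'k::field_char_0) nsym" where
  "nsym_H I = Poly_Mapping.single I 1"

definition nsym2_H :: "'a sentence \<Rightarrow> 'a sentence \<Rightarrow> ('a, 'k::field_char_0) nsym2" where
  "nsym2_H J K = Poly_Mapping.single (J, K) 1"

definition coprod_word :: "'a list \<Rightarrow> ('a, 'k::field_char_0) nsym2" where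
  "coprod_word w = (\<Sum>(u, v) | u @ v = w. nsym2_H (word_sentence u) (word_sentence v))"

text \<open>The pruning coproduct. That it is the algebra morphism with the prescribed values on the
  \<open>H\<^bsub>(w)\<^esub>\<close> is shown in \<open>coprod_H_word\<close>, \<open>coprod_one\<close>, \<open>coprod_add\<close>, \<open>coprod_scale\<close> and
  \<open>coprod_mult\<close>.\<close>

definition coprod :: "('a, 'k::field_char_0) nsym \<Rightarrow> ('a, 'k) nsym2" where
  "coprod f = (\<Sum>I\<in>Poly_Mapping.keys f.
     Poly_Mapping.map ((*) (Poly_Mapping.lookup f I)) (prod_list (map coprod_word (words I))))"

text \<open>Formal series, given by their coefficients. An element \<open>f\<close> of NSym is viewed as the series
  \<open>Poly_Mapping.lookup f\<close>; in particular the unit series is \<open>Poly_Mapping.lookup 1\<close>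
  (and not the constant function \<open>1\<close>). Addition of series is pointwise.\<close>

type_synonym ('a, 'k) nsym_series = "'a sentence \<Rightarrow> 'k"
type_synonym ('a, 'k) nsym2_series = "'a sentence \<times> 'a sentence \<Rightarrow> 'k"

text \<open>The sum over all sentences has only finitely many nonzero terms, see
  \<open>finite_coprod_support\<close>.\<close>

definition coprod_series :: "('a, 'k::field_char_0) nsym_series \<Rightarrow> ('a, 'k) nsym2_series" where
  "coprod_series G = (\<lambda>JK. \<Sum>I. G I * Poly_Mapping.lookup (coprod (nsym_H I)) JK)"

definition tensor_series ::
  "('a, 'k::field_char_0) nsym_series \<Rightarrow> ('a, 'k) nsym_series \<Rightarrow> ('a, 'k) nsym2_series"
  (infixr \<open>\<otimes>\<^sub>s\<close> 70) where
  "G1 \<otimes>\<^sub>s G2 = (\<lambda>(J, K). G1 J * G2 K)"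

definition H_series :: "'a set \<Rightarrow> ('a, 'k::field_char_0) nsym_series" where
  "H_series A = (\<lambda>I. of_bool (I \<in> word_sentence ` nonempty_words A))"


section \<open>The defining properties of the coproduct\<close>

lemma nsym_H_empty: "nsym_H 0 = 1"
  by (simp add: nsym_H_def)

lemma nsym_H_mult: "nsym_H I * nsym_H J = nsym_H (I + J)"
  by (simp add: nsym_H_def mult_single)

lemma nsym2_H_mult: "nsym2_H J K * nsym2_H J' K' = nsym2_H (J + J') (K + K')"
  by (simp add: nsym2_H_def mult_single)

lemma words_plus: "words (I + J) = words I @ words J"
  by transfer simp

lemma words_zero: "words 0 = []"
  by transfer simp

lemma coprod_alt:
  assumes "finite S" "Poly_Mapping.keys f \<subseteq> S"
  shows "coprod f = (\<Sum>I\<in>S. Poly_Mapping.single 0 (Poly_Mapping.lookup f I) *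
    prod_list (map coprod_word (words I)))"
  unfolding coprod_def mult_map_scale_conv_mult
  by (rule sum.mono_neutral_left) (use assms in \<open>auto simp: in_keys_iff\<close>)

lemma coprod_single:
  "coprod (Poly_Mapping.single I c) =
     Poly_Mapping.single 0 c * prod_list (map coprod_word (words I))"
  by (subst coprod_alt[of "{I}"]) auto

lemma coprod_H: "coprod (nsym_H I) = prod_list (map coprod_word (words I))"
  by (simp add: nsym_H_def coprod_single)

lemma coprod_one: "coprod 1 = 1"
  by (simp add: coprod_H words_zero flip: nsym_H_empty)

lemma coprod_H_word:
  "coprod (nsym_H (word_sentence w)) =
     (\<Sum>(u, v) | u @ v = w. nsym2_H (word_sentence u) (word_sentence v))"
proof (cases "w = []")
  case True
  have "word_sentence [] = (0 :: 'a sentence)" by transfer simp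
  moreover have "{(u, v). u @ v = ([] :: 'a list)} = {([], [])}" by auto
  ultimately show ?thesis
    using True by (simp add: nsym_H_empty nsym2_H_def coprod_one flip: zero_prod_def)
next
  case False
  then have "words (word_sentence w) = [w]" by transfer simp
  then show ?thesis by (simp add: coprod_H coprod_word_def)
qed

lemma coprod_add: "coprod (f + g) = coprod f + coprod g"
proof -
  let ?S = "Poly_Mapping.keys f \<union> Poly_Mapping.keys g"
  have "Poly_Mapping.keys (f + g) \<subseteq> ?S" by (rule keys_add)
  then show ?thesis
    by (simp add: coprod_alt[of ?S] lookup_add single_add distrib_right sum.distrib)
qed

lemma coprod_scale:
  "coprod (Poly_Mapping.map ((*) c) f) = Poly_Mapping.map ((*) c) (coprod f)"
proof -
  have l: "Poly_Mapping.lookup (Poly_Mapping.map ((*) c) f) I = c * Poly_Mapping.lookup f I" for I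
    by (simp add: Poly_Mapping.map.rep_eq when_def)
  have "Poly_Mapping.keys (Poly_Mapping.map ((*) c) f) \<subseteq> Poly_Mapping.keys f"
    by (auto simp: in_keys_iff l)
  then show ?thesis
    by (simp only: coprod_alt[of "Poly_Mapping.keys f"] finite_keys order_refl l)
       (simp add: mult_map_scale_conv_mult sum_distrib_left mult_single flip: mult.assoc)
qed

lemma poly_mapping_sum_singles:
  "(\<Sum>x\<in>Poly_Mapping.keys f. Poly_Mapping.single x (Poly_Mapping.lookup f x)) = f"
  by (rule poly_mapping_eqI) (auto simp: lookup_sum lookup_single when_def in_keys_iff)

lemma single_zero_commute:
  fixes c :: "'k::comm_ring_1" and f :: "'b::monoid_add \<Rightarrow>\<^sub>0 'k"
  shows "f * Poly_Mapping.single 0 c = Poly_Mapping.single 0 c * f"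
proof -
  let ?f = "\<Sum>x\<in>Poly_Mapping.keys f. Poly_Mapping.single x (Poly_Mapping.lookup f x)"
  have "?f * Poly_Mapping.single 0 c = Poly_Mapping.single 0 c * ?f"
    by (simp add: sum_distrib_left sum_distrib_right mult_single mult.commute)
  then show ?thesis by (simp only: poly_mapping_sum_singles)
qed

lemma coprod_sum: "coprod (sum h S) = (\<Sum>x\<in>S. coprod (h x))"
  by (induction S rule: infinite_finite_induct) (simp_all add: coprod_add coprod_def[of 0])

lemma coprod_mult: "coprod (f * g) = coprod f * coprod g"
proof -
  have single: "coprod (Poly_Mapping.single I c * Poly_Mapping.single J d) =
      coprod (Poly_Mapping.single I c) * coprod (Poly_Mapping.single J d)"
    for I J :: "'a sentence" and c d :: 'b
  proof -
    let ?P = "\<lambda>I. prod_list (map coprod_word (words I)) :: ('a, 'b) nsym2"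
    have "coprod (Poly_Mapping.single I c) * coprod (Poly_Mapping.single J d) =
        Poly_Mapping.single 0 c * (?P I * Poly_Mapping.single 0 d) * ?P J"
      by (simp add: coprod_single mult.assoc)
    also have "\<dots> = (Poly_Mapping.single 0 c * Poly_Mapping.single 0 d) * (?P I * ?P J)"
      by (simp only: single_zero_commute[of "?P I"] mult.assoc)
    also have "\<dots> = coprod (Poly_Mapping.single I c * Poly_Mapping.single J d)"
      by (simp add: mult_single coprod_single words_plus)
    finally show ?thesis by simp
  qed
  let ?s = "\<lambda>f :: ('a, 'b) nsym.
    \<Sum>x\<in>Poly_Mapping.keys f. Poly_Mapping.single x (Poly_Mapping.lookup f x)"
  have "coprod (?s f * ?s g) = coprod (?s f) * coprod (?s g)"
    unfolding sum_product coprod_sum single ..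
  then show ?thesis by (simp only: poly_mapping_sum_singles)
qed


section \<open>Local finiteness, and restriction to an alphabet\<close>

abbreviation sentence_letters :: "'a sentence \<Rightarrow> 'a multiset" where
  "sentence_letters I \<equiv> mset (concat (words I))"

lemma keys_coprod_word:
  assumes "(J, K) \<in> Poly_Mapping.keys (coprod_word w :: ('a, 'k::field_char_0) nsym2)"
  shows "sentence_letters J + sentence_letters K = mset w"
proof -
  have c: "concat (words (word_sentence u)) = u" for u :: "'a list"
    by transfer simp
  have "Poly_Mapping.lookup (coprod_word w :: ('a, 'k) nsym2) (J, K) \<noteq> 0"
    using assms by (simp add: in_keys_iff)
  then obtain uv where "uv \<in> {(u, v). u @ v = w}"
    "Poly_Mapping.lookup (case uv of (u, v) \<Rightarrow>
       (nsym2_H (word_sentence u) (word_sentence v) :: ('a, 'k) nsym2)) (J, K) \<noteq> 0"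
    unfolding coprod_word_def lookup_sum by (rule sum.not_neutral_contains_not_neutral)
  then obtain u v where "u @ v = w" "J = word_sentence u" "K = word_sentence v"
    by (auto simp: nsym2_H_def lookup_single when_def split: if_splits)
  then show ?thesis by (auto simp: c)
qed

lemma keys_coprod_letters:
  assumes "(J, K) \<in> Poly_Mapping.keys (coprod (nsym_H I :: ('a, 'k::field_char_0) nsym))"
  shows "sentence_letters J + sentence_letters K = sentence_letters I"
proof -
  have "sentence_letters J + sentence_letters K = mset (concat ws)"
    if "(J, K) \<in> Poly_Mapping.keys (prod_list (map coprod_word ws) :: ('a, 'k) nsym2)" for ws J K
    using that
  proof (induction ws arbitrary: J K)
    case Nil
    then show ?case by (simp add: zero_prod_def words_zero)
  next
    case (Cons w ws)
    then obtain J1 K1 J2 K2 where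
      "(J1, K1) \<in> Poly_Mapping.keys (coprod_word w :: ('a, 'k) nsym2)"
      "(J2, K2) \<in> Poly_Mapping.keys (prod_list (map coprod_word ws) :: ('a, 'k) nsym2)"
      "J = J1 + J2" "K = K1 + K2"
      using keys_mult[of "coprod_word w :: ('a, 'k) nsym2" "prod_list (map coprod_word ws)"]
      by (fastforce simp: plus_prod_def)
    with keys_coprod_word[of J1 K1 w, where 'k = 'k] Cons.IH[of J2 K2] show ?case
      by (simp add: words_plus) (metis add.assoc add.left_commute)
  qed
  with assms show ?thesis by (simp add: coprod_H)
qed

lemma finite_coprod_support:
  "finite {I. Poly_Mapping.lookup (coprod (nsym_H I :: ('a, 'k::field_char_0) nsym)) JK \<noteq> 0}"
proof (cases JK)
  case (Pair J K)
  define M where "M = sentence_letters J + sentence_letters K"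
  let ?W = "{w. set w \<subseteq> set_mset M \<and> length w \<le> size M}"
  let ?L = "{ws. set ws \<subseteq> ?W \<and> length ws \<le> size M}"
  have "I \<in> Sentence ` ?L"
    if "Poly_Mapping.lookup (coprod (nsym_H I :: ('a, 'k) nsym)) JK \<noteq> 0" for I
  proof -
    have M: "mset (concat (words I)) = M"
      using that keys_coprod_letters[of J K I, where 'k = 'k]
      unfolding M_def Pair by (simp add: in_keys_iff)
    then have len: "length (concat (words I)) = size M" and
      letters: "set (concat (words I)) = set_mset M"
      by (metis size_mset, metis set_mset_mset)
    have ne: "[] \<notin> set (words I)" using words[of I] by simp
    have "length ws \<le> length (concat ws)" if "[] \<notin> set ws" for ws :: "'a list list"
      using that
    proof (induction ws)
      case (Cons w ws)
      then show ?case by (cases w) auto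
    qed simp
    then have "length (words I) \<le> size M" using ne len by metis
    moreover have "set w \<subseteq> set_mset M" "length w \<le> size M" if "w \<in> set (words I)" for w
    proof -
      show "set w \<subseteq> set_mset M" using that letters by auto
      show "length w \<le> size M"
        using that unfolding len[symmetric] length_concat by (intro member_le_sum_list) auto
    qed
    ultimately have "words I \<in> ?L" by auto
    then have "Sentence (words I) \<in> Sentence ` ?L" by (rule imageI)
    then show ?thesis by (simp only: words_inverse)
  qed
  then have "{I. Poly_Mapping.lookup (coprod (nsym_H I :: ('a, 'k) nsym)) JK \<noteq> 0} \<subseteq> Sentence ` ?L"
    unfolding subset_iff mem_Collect_eq by (intro allI impI)
  moreover have "finite ?L" by (intro finite_lists_length_le finite_set_mset)
  ultimately show ?thesis by (rule finite_subset[OF _ finite_imageI])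
qed

lemma lookup_coprod:
  "Poly_Mapping.lookup (coprod f) JK = (\<Sum>I\<in>Poly_Mapping.keys f.
     Poly_Mapping.lookup f I * Poly_Mapping.lookup (coprod (nsym_H I)) JK)"
  unfolding coprod_H coprod_def[of f] lookup_sum
  by (rule sum.cong) (simp_all add: Poly_Mapping.map.rep_eq when_def)

lemma coprod_series_lookup:
  "coprod_series (Poly_Mapping.lookup f) = Poly_Mapping.lookup (coprod f)"
proof
  fix JK
  have "coprod_series (Poly_Mapping.lookup f) JK = (\<Sum>I\<in>Poly_Mapping.keys f.
      Poly_Mapping.lookup f I * Poly_Mapping.lookup (coprod (nsym_H I)) JK)"
    unfolding coprod_series_def
    by (rule Sum_any.expand_superset) (auto simp: in_keys_iff)
  also have "\<dots> = Poly_Mapping.lookup (coprod f) JK"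
    by (rule lookup_coprod[symmetric])
  finally show "coprod_series (Poly_Mapping.lookup f) JK = Poly_Mapping.lookup (coprod f) JK" .
qed

lemma sentences_iff: "I \<in> sentences A \<longleftrightarrow> set_mset (sentence_letters I) \<subseteq> A"
  using words[of I] by (auto simp: sentences_def nonempty_words_def)

lemma keys_nsym_mult:
  assumes "Poly_Mapping.keys f \<subseteq> sentences A" "Poly_Mapping.keys g \<subseteq> sentences A"
  shows "Poly_Mapping.keys (f * g :: ('a, 'k::field_char_0) nsym) \<subseteq> sentences A"
proof
  fix I assume "I \<in> Poly_Mapping.keys (f * g)"
  then obtain I1 I2 where "I = I1 + I2" "I1 \<in> sentences A" "I2 \<in> sentences A"
    using keys_mult[of f g] assms by blast
  then show "I \<in> sentences A" by (simp add: sentences_def words_plus)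
qed

lemma keys_coprod:
  assumes "Poly_Mapping.keys (f :: ('a, 'k::field_char_0) nsym) \<subseteq> sentences A"
  shows "Poly_Mapping.keys (coprod f) \<subseteq> sentences A \<times> sentences A"
proof safe
  fix J K assume "(J, K) \<in> Poly_Mapping.keys (coprod f)"
  then have "(\<Sum>I\<in>Poly_Mapping.keys f. Poly_Mapping.lookup f I *
      Poly_Mapping.lookup (coprod (nsym_H I :: ('a, 'k) nsym)) (J, K)) \<noteq> 0"
    unfolding in_keys_iff by (subst (asm) lookup_coprod)
  then obtain I where "I \<in> Poly_Mapping.keys f"
    "Poly_Mapping.lookup f I *
       Poly_Mapping.lookup (coprod (nsym_H I :: ('a, 'k) nsym)) (J, K) \<noteq> 0"
    by (rule sum.not_neutral_contains_not_neutral)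
  then have "I \<in> sentences A"
    and *: "sentence_letters I = sentence_letters J + sentence_letters K"
    using assms keys_coprod_letters[of J K I, where 'k = 'k] by (auto simp: in_keys_iff)
  then have "set_mset (sentence_letters J + sentence_letters K) \<subseteq> A"
    by (simp only: sentences_iff)
  then show "J \<in> sentences A" "K \<in> sentences A"
    unfolding sentences_iff by auto
qed

end

theory Submission
  imports Defs
begin

text \<open>Compare coefficients at each basis element \<open>(J, K)\<close>. Splitting a single
  word yields only sentences of at most one word, that is, elements of
  \<open>range word_sentence\<close>, so both sides vanish unless \<open>J\<close> and
  \<open>K\<close> come from words \<open>u\<close> and \<open>v\<close>. Such a pair occurs in the
  coproduct of exactly one word, \<open>u @ v\<close>, and with coefficient 1
  (\<open>coprod_series_H_word_pair\<close>). Hence the left coefficient tells whether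
  \<open>u @ v\<close> is a non-empty word over \<open>A\<close>; the three terms on the right split
  this into the disjoint cases \<open>u\<close> empty, \<open>v\<close> empty, neither
  empty.\<close>

lemma inj_word_sentence: "inj word_sentence"
  by (rule injI) (transfer; simp split: if_splits)

lemma word_sentence_eq_iff: "word_sentence u = word_sentence v \<longleftrightarrow> u = v"
  using inj_word_sentence by (rule inj_eq)

text \<open>Lets the unit series be treated on \<open>range word_sentence\<close> along with the
  words.\<close>

lemma zero_eq_word_sentence: "0 = word_sentence []"
  by transfer simp

text \<open>A factorization is determined by the length of its prefix.\<close>

lemma finite_factorizations: "finite {(u, v). u @ v = w}"
proof (rule finite_subset)
  show "{(u, v). u @ v = w} \<subseteq> (\<lambda>n. (take n w, drop n w)) ` {..length w}"
  proof clarify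
    fix u v assume "w = u @ v"
    then show "(u, v) \<in> (\<lambda>n. (take n (u @ v), drop n (u @ v))) ` {..length (u @ v)}"
      by (intro image_eqI[of _ _ "length u"]) auto
  qed
qed simp

lemma lookup_coprod_word:
  "Poly_Mapping.lookup (coprod (nsym_H (word_sentence w)) :: ('a, 'k::field_char_0) nsym2) JK =
     (\<Sum>(u, v) | u @ v = w. of_bool (JK = (word_sentence u, word_sentence v)))"
  by (auto simp: coprod_H_word lookup_sum nsym2_H_def lookup_single when_def intro!: sum.cong)

text \<open>By injectivity of \<open>word_sentence\<close>, also at the empty word, distinct
  factorizations give distinct basis elements, so no coefficient exceeds 1.\<close>

lemma lookup_coprod_word_pair:
  "Poly_Mapping.lookup (coprod (nsym_H (word_sentence w)) :: ('a, 'k::field_char_0) nsym2)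
     (word_sentence u, word_sentence v) = of_bool (u @ v = w)"
proof -
  have "Poly_Mapping.lookup (coprod (nsym_H (word_sentence w)) :: ('a, 'k) nsym2)
      (word_sentence u, word_sentence v) = (\<Sum>p | fst p @ snd p = w. of_bool (p = (u, v)))"
    by (auto simp: lookup_coprod_word word_sentence_eq_iff case_prod_unfold intro!: sum.cong)
  also have "\<dots> = of_bool (u @ v = w)"
    using finite_factorizations[of w]
    by (simp add: of_bool_def case_prod_unfold)
  finally show ?thesis .
qed

lemma lookup_coprod_word_outside:
  assumes "JK \<notin> range word_sentence \<times> range word_sentence"
  shows "Poly_Mapping.lookup (coprod (nsym_H (word_sentence w)) :: ('a, 'k::field_char_0) nsym2)
    JK = 0"
  using assms by (auto simp: lookup_coprod_word intro!: sum.neutral)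

lemma H_series_word: "H_series A (word_sentence u) = of_bool (u \<noteq> [] \<and> set u \<subseteq> A)"
  by (auto simp: H_series_def nonempty_words_def inj_image_mem_iff[OF inj_word_sentence])

lemma H_series_outside: "I \<notin> range word_sentence \<Longrightarrow> H_series A I = 0"
  by (auto simp: H_series_def)

lemma lookup_one_word: "Poly_Mapping.lookup 1 (word_sentence u) = of_bool (u = [])"
  by (simp add: lookup_one when_def zero_eq_word_sentence word_sentence_eq_iff)

lemma lookup_one_outside: "I \<notin> range word_sentence \<Longrightarrow> Poly_Mapping.lookup 1 I = 0"
  by (auto simp: lookup_one zero_eq_word_sentence)

lemma coprod_series_H_word_pair:
  "coprod_series (H_series A :: ('a, 'k::field_char_0) nsym_series)
     (word_sentence u, word_sentence v) = H_series A (word_sentence (u @ v))"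
proof -
  let ?c = "\<lambda>I. H_series A I *
    Poly_Mapping.lookup (coprod (nsym_H I) :: ('a, 'k) nsym2) (word_sentence u, word_sentence v)"
  \<comment> \<open>Sentences of two or more words are killed by the factor
    \<open>H_series A I\<close>, other words by the coproduct coefficient.\<close>
  have "?c I = 0" if "I \<noteq> word_sentence (u @ v)" for I
    using that
    by (cases "I \<in> range word_sentence") (auto simp: lookup_coprod_word_pair H_series_outside)
  then have "(\<Sum>I. ?c I) = (\<Sum>I\<in>{word_sentence (u @ v)}. ?c I)"
    by (intro Sum_any.expand_superset) auto
  then show ?thesis
    by (simp add: coprod_series_def lookup_coprod_word_pair)
qed

lemma coprod_series_H_outside:
  assumes "JK \<notin> range word_sentence \<times> range word_sentence"
  shows "coprod_series (H_series A :: ('a, 'k::field_char_0) nsym_series) JK = 0"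
proof -
  have "H_series A I * Poly_Mapping.lookup (coprod (nsym_H I) :: ('a, 'k) nsym2) JK = 0" for I
    using assms
    by (cases "I \<in> range word_sentence") (auto simp: lookup_coprod_word_outside H_series_outside)
  then show ?thesis
    \<comment> \<open>With \<open>mult_eq_0_iff\<close> the vanishing product would become a
      disjunction, unusable for rewriting the summand.\<close>
    by (simp add: coprod_series_def del: mult_eq_0_iff)
qed

theorem proposition6p5:
  fixes A :: "'a set"
  assumes "finite A"
  shows "coprod_series (H_series A :: ('a, 'k::field_char_0) nsym_series) =
    Poly_Mapping.lookup 1 \<otimes>\<^sub>s H_series A + H_series A \<otimes>\<^sub>s Poly_Mapping.lookup 1
      + H_series A \<otimes>\<^sub>s H_series A"
proof
  fix JK :: "'a sentence \<times> 'a sentence"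
  show "coprod_series (H_series A :: ('a, 'k) nsym_series) JK =
    (Poly_Mapping.lookup 1 \<otimes>\<^sub>s H_series A + H_series A \<otimes>\<^sub>s Poly_Mapping.lookup 1
      + H_series A \<otimes>\<^sub>s H_series A) JK"
  proof (cases "JK \<in> range word_sentence \<times> range word_sentence")
    case True
    then obtain u v where "JK = (word_sentence u, word_sentence v)" by auto
    then show ?thesis
      \<comment> \<open>If \<open>u\<close> and \<open>v\<close> are both empty, all terms are 0,
        since \<open>H_series A\<close> has no constant term.\<close>
      by (auto simp: coprod_series_H_word_pair tensor_series_def H_series_word lookup_one_word)
  next
    case False
    then show ?thesis
      by (cases JK)
        (auto simp: coprod_series_H_outside tensor_series_def H_series_outside lookup_one_outside)
  qed
qed

end
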